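(* If a closed subspace $\mathscr{X}_0$ of $X^{\odot\star}$ is an admissible range for $\{T_0(t)\}_{t\ge0}$ on some interval, then it is an admissible range for $\{T_0(t)\}_{t\ge0}$ on every interval.
   Context: All intervals are non-degenerate but otherwise arbitrary (not necessarily open, closed or bounded). For a Banach space $E$, $\langle x,x^\star\rangle:=x^\star(x)$. Let $\{T_0(t)\}_{t\ge 0}$ be a $\mathcal{C}_0$-semigroup of bounded linear operators on a real or complex Banach space $X$. The sun dual is $X^\odot:=\{x^\star\in X^\star: \lim_{t\downarrow 0}\|T_0(t)^\star x^\star-x^\star\|=0\}$, a norm-closed subspace of $X^\star$ invariant under all $T_0(t)^\star$; $T_0^\odot(t):=T_0(t)^\star|_{X^\odot}$; $X^{\odot\star}:=(X^\odot)^\star$ and $T_0^{\odot\star}(t):=(T_0^\odot(t))^\star$. The canonical embedding $j:X\to X^{\odot\star}$ is $\langle x^\odot,jx\rangle:=\langle x,x^\odot\rangle$; it is injective with norm-closed range $jX$. It is not assumed that $X$ is sun-reflexive. A closed subspace $\mathscr{X}_0$ of $X^{\odot\star}$ is an admissible range for $\{T_0(t)\}_{t\ge0}$ on the interval $J$ if for every norm-continuous $f:J\to\mathscr{X}_0$ and all $t,s\in J$ with $t\ge s$ the weak$^\star$ integral $\int_s^tT_0^{\odot\star}(t-\tau)f(\tau)\,d\tau$ belongs to $jX$, where $\langle x^\odot,\int_s^tq(\tau)d\tau\rangle:=\int_s^t\langle x^\odot,q(\tau)\rangle d\tau$ for all $x^\odot\in X^\odot$. *)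

theory Defs
  imports "HOL-Analysis.Analysis" "HOL-Library.Function_Algebras"
begin

section \<open>Banach spaces over the real or complex numbers\<close>

text \<open>
  The type class \<open>banach\<close> only provides a real vector space. The scalar field is therefore a type
  \<open>'k\<close>, and scalar multiplication by \<open>'k\<close> is an explicit operation extending \<open>(*\<^sub>R)\<close>.
  The types \<open>real\<close> and \<open>complex\<close> are instances of \<open>{real_normed_field, banach}\<close>; up to isometric
  isomorphism there are no others (Gelfand--Mazur).
\<close>

locale banach_space_over = vector_space scaleK
  for scaleK :: "'k::{real_normed_field, banach} \<Rightarrow> 'a::banach \<Rightarrow> 'a" +
  assumes scale_of_real: "scaleK (of_real r) x = r *\<^sub>R x"
    and norm_scale: "norm (scaleK c x) = norm c * norm x"

lemma banach_space_over_scaleR: "banach_space_over ((*\<^sub>R) :: real \<Rightarrow> 'a::banach \<Rightarrow> 'a)"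
  by unfold_locales (auto simp: algebra_simps)

lemma banach_space_over_mult:
  "banach_space_over ((*) :: 'k \<Rightarrow> 'k \<Rightarrow> 'k::{real_normed_field, banach})"
  by unfold_locales (auto simp: algebra_simps scaleR_conv_of_real norm_mult)


section \<open>Dual spaces\<close>

text \<open>The dual of the whole space; its norm is the operator norm of the type \<open>'a \<Rightarrow>\<^sub>L 'k\<close>.\<close>

definition dual_space :: "('k \<Rightarrow> 'a \<Rightarrow> 'a) \<Rightarrow> ('a::banach \<Rightarrow>\<^sub>L 'k::{real_normed_field, banach}) set"
  where "dual_space scaleK = {\<phi>. Vector_Spaces.linear scaleK (*) (blinfun_apply \<phi>)}"

definition dual_scale :: "'k \<Rightarrow> ('a \<Rightarrow>\<^sub>L 'k) \<Rightarrow> ('a::banach \<Rightarrow>\<^sub>L 'k::{real_normed_field, banach})"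
  where "dual_scale c \<phi> = blinfun_mult_right c o\<^sub>L \<phi>"

text \<open>
  The dual of a subspace \<open>S\<close> of the dual space. There is no type of functionals on \<open>S\<close>, so
  such a functional is represented by its extension by \<open>0\<close> to the whole type; this extension is only
  required to be linear and bounded on \<open>S\<close>.
\<close>

definition subspace_dual ::
    "('a::banach \<Rightarrow>\<^sub>L 'k::{real_normed_field, banach}) set \<Rightarrow> (('a \<Rightarrow>\<^sub>L 'k) \<Rightarrow> 'k) set"
  where "subspace_dual S = {F.
    (\<forall>\<phi>\<in>S. \<forall>\<psi>\<in>S. F (\<phi> + \<psi>) = F \<phi> + F \<psi>) \<and>
    (\<forall>c. \<forall>\<phi>\<in>S. F (dual_scale c \<phi>) = c * F \<phi>) \<and>
    (\<exists>C. \<forall>\<phi>\<in>S. norm (F \<phi>) \<le> C * norm \<phi>) \<and>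
    (\<forall>\<phi>. \<phi> \<notin> S \<longrightarrow> F \<phi> = 0)}"

definition subspace_dual_norm ::
    "('a::banach \<Rightarrow>\<^sub>L 'k::{real_normed_field, banach}) set \<Rightarrow> (('a \<Rightarrow>\<^sub>L 'k) \<Rightarrow> 'k) \<Rightarrow> real"
  where "subspace_dual_norm S F = (SUP \<phi>\<in>{\<phi>\<in>S. norm \<phi> \<le> 1}. norm (F \<phi>))"

text \<open>
  The locale \<open>Metric_space\<close> requires the distance to be nonnegative off the carrier as well, where
  the supremum above need not be meaningful.
\<close>

definition subspace_dual_dist ::
    "('a::banach \<Rightarrow>\<^sub>L 'k::{real_normed_field, banach}) set \<Rightarrow>
      (('a \<Rightarrow>\<^sub>L 'k) \<Rightarrow> 'k) \<Rightarrow> (('a \<Rightarrow>\<^sub>L 'k) \<Rightarrow> 'k) \<Rightarrow> real"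
  where "subspace_dual_dist S F G =
    (if F \<in> subspace_dual S \<and> G \<in> subspace_dual S then subspace_dual_norm S (F - G) else 0)"

definition subspace_dual_topology ::
    "('a::banach \<Rightarrow>\<^sub>L 'k::{real_normed_field, banach}) set \<Rightarrow> (('a \<Rightarrow>\<^sub>L 'k) \<Rightarrow> 'k) topology"
  where "subspace_dual_topology S =
    Metric_space.mtopology (subspace_dual S) (subspace_dual_dist S)"

definition subspace_dual_scale ::
    "'k \<Rightarrow> (('a \<Rightarrow>\<^sub>L 'k) \<Rightarrow> 'k) \<Rightarrow> (('a::banach \<Rightarrow>\<^sub>L 'k::{real_normed_field, banach}) \<Rightarrow> 'k)"
  where "subspace_dual_scale c F = (\<lambda>\<phi>. c * F \<phi>)"

definition closed_subspace_of_dual ::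
    "('a::banach \<Rightarrow>\<^sub>L 'k::{real_normed_field, banach}) set \<Rightarrow> (('a \<Rightarrow>\<^sub>L 'k) \<Rightarrow> 'k) set \<Rightarrow> bool"
  where "closed_subspace_of_dual S V \<longleftrightarrow>
    module.subspace subspace_dual_scale V \<and> closedin (subspace_dual_topology S) V"

text \<open>
  The weak* integral of \<open>q\<close> over \<open>{s..t}\<close>. It is only applied to \<open>q\<close> for which every
  \<open>\<lambda>\<tau>. q \<tau> \<phi>\<close> with \<open>\<phi> \<in> S\<close> is continuous on \<open>{s..t}\<close>.
\<close>

definition weak_star_integral ::
    "('a::banach \<Rightarrow>\<^sub>L 'k::{real_normed_field, banach}) set \<Rightarrow> real \<Rightarrow> real \<Rightarrow>
      (real \<Rightarrow> ('a \<Rightarrow>\<^sub>L 'k) \<Rightarrow> 'k) \<Rightarrow> (('a \<Rightarrow>\<^sub>L 'k) \<Rightarrow> 'k)"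
  where "weak_star_integral S s t q =
    (\<lambda>\<phi>. if \<phi> \<in> S then integral {s..t} (\<lambda>\<tau>. q \<tau> \<phi>) else 0)"


section \<open>Semigroups and sun duals\<close>

locale C0_semigroup = banach_space_over scaleK
  for scaleK :: "'k::{real_normed_field, banach} \<Rightarrow> 'a::banach \<Rightarrow> 'a" +
  fixes T :: "real \<Rightarrow> 'a \<Rightarrow>\<^sub>L 'a"
  assumes T_linear: "0 \<le> t \<Longrightarrow> Vector_Spaces.linear scaleK scaleK (blinfun_apply (T t))"
    and T_0: "T 0 = id_blinfun"
    and T_add: "0 \<le> s \<Longrightarrow> 0 \<le> t \<Longrightarrow> T (s + t) = T s o\<^sub>L T t"
    and T_strongly_continuous: "((\<lambda>t. T t x) \<longlongrightarrow> x) (at_right 0)"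

text \<open>The Banach space adjoint of \<open>T t\<close> is \<open>\<lambda>\<phi>. \<phi> o\<^sub>L T t\<close>.\<close>

definition sun_dual ::
    "('k \<Rightarrow> 'a \<Rightarrow> 'a) \<Rightarrow> (real \<Rightarrow> 'a \<Rightarrow>\<^sub>L 'a) \<Rightarrow> ('a::banach \<Rightarrow>\<^sub>L 'k::{real_normed_field, banach}) set"
  where "sun_dual scaleK T =
    {\<phi> \<in> dual_space scaleK. ((\<lambda>t. norm ((\<phi> o\<^sub>L T t) - \<phi>)) \<longlongrightarrow> 0) (at_right 0)}"

definition sun_star ::
    "('k \<Rightarrow> 'a \<Rightarrow> 'a) \<Rightarrow> (real \<Rightarrow> 'a \<Rightarrow>\<^sub>L 'a) \<Rightarrow>
      (('a::banach \<Rightarrow>\<^sub>L 'k::{real_normed_field, banach}) \<Rightarrow> 'k) set"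
  where "sun_star scaleK T = subspace_dual (sun_dual scaleK T)"

definition T_sun_star ::
    "('k \<Rightarrow> 'a \<Rightarrow> 'a) \<Rightarrow> (real \<Rightarrow> 'a \<Rightarrow>\<^sub>L 'a) \<Rightarrow> real \<Rightarrow>
      (('a \<Rightarrow>\<^sub>L 'k) \<Rightarrow> 'k) \<Rightarrow> (('a::banach \<Rightarrow>\<^sub>L 'k::{real_normed_field, banach}) \<Rightarrow> 'k)"
  where "T_sun_star scaleK T t F = (\<lambda>\<phi>. if \<phi> \<in> sun_dual scaleK T then F (\<phi> o\<^sub>L T t) else 0)"

definition sun_embedding ::
    "('k \<Rightarrow> 'a \<Rightarrow> 'a) \<Rightarrow> (real \<Rightarrow> 'a \<Rightarrow>\<^sub>L 'a) \<Rightarrow> 'a \<Rightarrow>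
      (('a::banach \<Rightarrow>\<^sub>L 'k::{real_normed_field, banach}) \<Rightarrow> 'k)"
  where "sun_embedding scaleK T x = (\<lambda>\<phi>. if \<phi> \<in> sun_dual scaleK T then \<phi> x else 0)"


section \<open>Admissible ranges\<close>

definition nondegenerate_interval :: "real set \<Rightarrow> bool"
  where "nondegenerate_interval J \<longleftrightarrow> is_interval J \<and> (\<exists>a\<in>J. \<exists>b\<in>J. a < b)"

definition admissible_range ::
    "('k \<Rightarrow> 'a \<Rightarrow> 'a) \<Rightarrow> (real \<Rightarrow> 'a \<Rightarrow>\<^sub>L 'a) \<Rightarrow> real set \<Rightarrow>
      (('a::banach \<Rightarrow>\<^sub>L 'k::{real_normed_field, banach}) \<Rightarrow> 'k) set \<Rightarrow> bool"
  where "admissible_range scaleK T J X0 \<longleftrightarrow>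
    closed_subspace_of_dual (sun_dual scaleK T) X0 \<and>
    (\<forall>f. continuous_map (top_of_set J) (subtopology (subspace_dual_topology (sun_dual scaleK T)) X0) f \<longrightarrow>
      (\<forall>s\<in>J. \<forall>t\<in>J. s \<le> t \<longrightarrow>
        weak_star_integral (sun_dual scaleK T) s t (\<lambda>\<tau>. T_sun_star scaleK T (t - \<tau>) (f \<tau>))
          \<in> range (sun_embedding scaleK T)))"


section \<open>Basic properties\<close>

lemma module_subspace_dual_scale:
  "module (subspace_dual_scale :: 'k \<Rightarrow> (('a::banach \<Rightarrow>\<^sub>L 'k::{real_normed_field, banach}) \<Rightarrow> 'k) \<Rightarrow> _)"
  by unfold_locales (auto simp: subspace_dual_scale_def fun_eq_iff algebra_simps)

lemma dual_scale_apply [simp]: "dual_scale c \<phi> x = c * \<phi> x"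
  by (simp add: dual_scale_def)

context banach_space_over
begin

lemma dual_space_iff: "\<phi> \<in> dual_space scaleK \<longleftrightarrow> (\<forall>c x. \<phi> (scaleK c x) = c * \<phi> x)"
proof -
  have "vector_space ((*) :: 'k \<Rightarrow> 'k \<Rightarrow> 'k)"
    by unfold_locales (auto simp: algebra_simps)
  then show ?thesis
    unfolding dual_space_def
    using vector_space_axioms
    by (auto simp: Vector_Spaces.linear_iff blinfun.add_right)
qed

end

lemma norm_dual_scale:
  fixes \<phi> :: "'a::banach \<Rightarrow>\<^sub>L 'k::{real_normed_field, banach}"
  shows "norm (dual_scale c \<phi>) = norm c * norm \<phi>"
proof (cases "c = 0")
  case True
  then have "dual_scale c \<phi> = 0"
    by (intro blinfun_eqI) (simp add: dual_scale_def)
  with True show ?thesis by simp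
next
  case False
  have le: "norm (dual_scale d \<psi>) \<le> norm d * norm \<psi>" for d and \<psi> :: "'a \<Rightarrow>\<^sub>L 'k"
  proof (rule norm_blinfun_bound)
    show "norm (dual_scale d \<psi> x) \<le> norm d * norm \<psi> * norm x" for x
      using norm_blinfun[of \<psi> x]
      by (simp add: dual_scale_def norm_mult mult_left_mono mult.assoc)
  qed simp
  have "dual_scale (inverse c) (dual_scale c \<phi>) = \<phi>"
    using False by (intro blinfun_eqI) (simp add: dual_scale_def)
  then have "norm \<phi> \<le> norm (inverse c) * norm (dual_scale c \<phi>)"
    using le[of "inverse c" "dual_scale c \<phi>"] by simp
  then have "norm c * norm \<phi> \<le> norm (dual_scale c \<phi>)"
    using False by (simp add: norm_inverse divide_simps norm_divide mult.commute)
  with le[of c \<phi>] show ?thesis by simp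
qed

lemma subspace_dual_diff:
  assumes "F \<in> subspace_dual S" "G \<in> subspace_dual S"
  shows "F - G \<in> subspace_dual S"
proof -
  obtain C where C: "\<And>\<phi>. \<phi> \<in> S \<Longrightarrow> norm (F \<phi>) \<le> C * norm \<phi>"
    using assms(1) unfolding subspace_dual_def by blast
  obtain D where D: "\<And>\<phi>. \<phi> \<in> S \<Longrightarrow> norm (G \<phi>) \<le> D * norm \<phi>"
    using assms(2) unfolding subspace_dual_def by blast
  have "norm ((F - G) \<phi>) \<le> (C + D) * norm \<phi>" if "\<phi> \<in> S" for \<phi>
    using C[OF that] D[OF that] norm_triangle_ineq4[of "F \<phi>" "G \<phi>"] by (simp add: algebra_simps)
  then have "\<exists>B. \<forall>\<phi>\<in>S. norm ((F - G) \<phi>) \<le> B * norm \<phi>" by blast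
  then show ?thesis
    using assms by (simp add: subspace_dual_def right_diff_distrib)
qed

lemma subspace_dual_norm_ge:
  assumes "F \<in> subspace_dual S" "\<phi> \<in> S" "norm \<phi> \<le> 1"
  shows "norm (F \<phi>) \<le> subspace_dual_norm S F"
proof -
  obtain C where C: "\<And>\<phi>. \<phi> \<in> S \<Longrightarrow> norm (F \<phi>) \<le> C * norm \<phi>"
    using assms unfolding subspace_dual_def by blast
  have "norm (F \<psi>) \<le> \<bar>C\<bar>" if "\<psi> \<in> S" "norm \<psi> \<le> 1" for \<psi>
  proof -
    have "norm (F \<psi>) \<le> \<bar>C\<bar> * norm \<psi>"
      using C[OF that(1)] by (meson abs_ge_self mult_right_mono norm_ge_zero order_trans)
    also have "\<dots> \<le> \<bar>C\<bar>" using that(2) by (simp add: mult_left_le)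
    finally show ?thesis .
  qed
  then have "bdd_above ((\<lambda>\<phi>. norm (F \<phi>)) ` {\<phi> \<in> S. norm \<phi> \<le> 1})"
    by (intro bdd_aboveI[of _ "\<bar>C\<bar>"]) auto
  then show ?thesis
    unfolding subspace_dual_norm_def using assms by (intro cSUP_upper) auto
qed

lemma subspace_dual_norm_bound:
  assumes "F \<in> subspace_dual S" "\<phi> \<in> S" "\<And>c \<phi>. \<phi> \<in> S \<Longrightarrow> dual_scale c \<phi> \<in> S"
  shows "norm (F \<phi>) \<le> subspace_dual_norm S F * norm \<phi>"
proof (cases "\<phi> = 0")
  case True
  have "norm (F \<phi>) \<le> C * norm \<phi> \<Longrightarrow> ?thesis" for C using True by simp
  then show ?thesis using assms unfolding subspace_dual_def by blast
next
  case False
  let ?c = "of_real (inverse (norm \<phi>))"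
  have "norm (dual_scale ?c \<phi>) = 1" using False by (simp add: norm_dual_scale norm_inverse)
  then have "norm (F (dual_scale ?c \<phi>)) \<le> subspace_dual_norm S F"
    using subspace_dual_norm_ge[of F S "dual_scale ?c \<phi>"] assms by simp
  moreover have "F (dual_scale ?c \<phi>) = ?c * F \<phi>"
    using assms unfolding subspace_dual_def by blast
  ultimately have "inverse (norm \<phi>) * norm (F \<phi>) \<le> subspace_dual_norm S F"
    by (simp add: norm_mult norm_inverse del: of_real_inverse)
  then show ?thesis
    using False by (simp add: divide_simps mult.commute split: if_splits)
qed

lemma Metric_space_subspace_dual:
  fixes S :: "('a::banach \<Rightarrow>\<^sub>L 'k::{real_normed_field, banach}) set"
  assumes S0: "0 \<in> S" and S: "\<And>c \<phi>. \<phi> \<in> S \<Longrightarrow> dual_scale c \<phi> \<in> S"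
  shows "Metric_space (subspace_dual S) (subspace_dual_dist S)"
proof
  show "0 \<le> subspace_dual_dist S F G" for F G
    using subspace_dual_norm_ge[OF subspace_dual_diff S0, of F G]
    by (auto simp: subspace_dual_dist_def intro: order_trans[OF norm_ge_zero])
  show "subspace_dual_dist S F G = subspace_dual_dist S G F" for F G
    by (auto simp: subspace_dual_dist_def subspace_dual_norm_def norm_minus_commute)
  show "subspace_dual_dist S F G = 0 \<longleftrightarrow> F = G"
    if FG: "F \<in> subspace_dual S" "G \<in> subspace_dual S" for F G
  proof
    assume "subspace_dual_dist S F G = 0"
    then have "F \<phi> = G \<phi>" if "\<phi> \<in> S" for \<phi>
      using subspace_dual_norm_bound[OF subspace_dual_diff[OF FG] that S] FG
      by (simp add: subspace_dual_dist_def)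
    moreover have "F \<phi> = G \<phi>" if "\<phi> \<notin> S" for \<phi>
      using FG that by (simp add: subspace_dual_def)
    ultimately show "F = G" by blast
  next
    assume "F = G"
    moreover have "{\<phi> \<in> S. norm \<phi> \<le> 1} \<noteq> {}" using S0 by (auto intro!: exI[of _ 0])
    ultimately show "subspace_dual_dist S F G = 0"
      using cSUP_const[of "{\<phi> \<in> S. norm \<phi> \<le> 1}" "0 :: real"]
      by (simp add: subspace_dual_dist_def subspace_dual_norm_def)
  qed
  show "subspace_dual_dist S F H \<le> subspace_dual_dist S F G + subspace_dual_dist S G H"
    if FGH: "F \<in> subspace_dual S" "G \<in> subspace_dual S" "H \<in> subspace_dual S" for F G H
  proof -
    have "subspace_dual_norm S (F - H) \<le> subspace_dual_norm S (F - G) + subspace_dual_norm S (G - H)"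
      unfolding subspace_dual_norm_def[of S "F - H"]
    proof (rule cSUP_least)
      show "{\<phi> \<in> S. norm \<phi> \<le> 1} \<noteq> {}" using S0 by (auto intro!: exI[of _ 0])
      show "norm ((F - H) \<phi>) \<le> subspace_dual_norm S (F - G) + subspace_dual_norm S (G - H)"
        if "\<phi> \<in> {\<phi> \<in> S. norm \<phi> \<le> 1}" for \<phi>
        using that FGH subspace_dual_norm_ge[of "F - G" S \<phi>] subspace_dual_norm_ge[of "G - H" S \<phi>]
          norm_triangle_ineq[of "(F - G) \<phi>" "(G - H) \<phi>"]
        by (simp add: subspace_dual_diff)
    qed
    then show ?thesis using FGH by (simp add: subspace_dual_dist_def)
  qed
qed

context C0_semigroup
begin

lemma sun_dualD:
  assumes "\<phi> \<in> sun_dual scaleK T"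
  shows "\<phi> \<in> dual_space scaleK" "((\<lambda>t. norm ((\<phi> o\<^sub>L T t) - \<phi>)) \<longlongrightarrow> 0) (at_right 0)"
  using assms by (auto simp: sun_dual_def)

lemma sun_dual_0: "0 \<in> sun_dual scaleK T"
proof -
  have "(0 o\<^sub>L T t) - 0 = (0 :: 'a \<Rightarrow>\<^sub>L 'k)" for t
    by (intro blinfun_eqI) simp
  then show ?thesis by (simp add: sun_dual_def dual_space_iff)
qed

lemma sun_dual_add:
  assumes "\<phi> \<in> sun_dual scaleK T" "\<psi> \<in> sun_dual scaleK T"
  shows "\<phi> + \<psi> \<in> sun_dual scaleK T"
proof -
  have eq: "((\<phi> + \<psi>) o\<^sub>L T t) - (\<phi> + \<psi>) = ((\<phi> o\<^sub>L T t) - \<phi>) + ((\<psi> o\<^sub>L T t) - \<psi>)" for t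
    by (intro blinfun_eqI) (simp add: blinfun.bilinear_simps)
  have "((\<lambda>t. norm (((\<phi> + \<psi>) o\<^sub>L T t) - (\<phi> + \<psi>))) \<longlongrightarrow> 0) (at_right 0)"
    unfolding eq
    using tendsto_add[OF sun_dualD(2)[OF assms(1), THEN tendsto_norm_zero_cancel]
        sun_dualD(2)[OF assms(2), THEN tendsto_norm_zero_cancel], THEN tendsto_norm]
    by simp
  then show ?thesis
    using assms by (simp add: sun_dual_def dual_space_iff blinfun.bilinear_simps algebra_simps)
qed

lemma sun_dual_scale:
  assumes "\<phi> \<in> sun_dual scaleK T"
  shows "dual_scale c \<phi> \<in> sun_dual scaleK T"
proof -
  have eq: "(dual_scale c \<phi> o\<^sub>L T t) - dual_scale c \<phi> = dual_scale c ((\<phi> o\<^sub>L T t) - \<phi>)" for t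
    by (intro blinfun_eqI) (simp add: blinfun.bilinear_simps algebra_simps)
  have "((\<lambda>t. norm ((dual_scale c \<phi> o\<^sub>L T t) - dual_scale c \<phi>)) \<longlongrightarrow> 0) (at_right 0)"
    unfolding eq norm_dual_scale by (intro tendsto_mult_right_zero sun_dualD(2) assms)
  then show ?thesis
    using assms by (simp add: sun_dual_def dual_space_iff)
qed

lemma sun_dual_invariant:
  assumes "\<phi> \<in> sun_dual scaleK T" "0 \<le> t"
  shows "\<phi> o\<^sub>L T t \<in> sun_dual scaleK T"
proof -
  have lim: "((\<lambda>h. norm ((\<phi> o\<^sub>L T h) - \<phi>) * norm (T t)) \<longlongrightarrow> 0) (at_right 0)"
    by (intro tendsto_mult_left_zero sun_dualD(2) assms)
  have "norm (((\<phi> o\<^sub>L T t) o\<^sub>L T h) - (\<phi> o\<^sub>L T t)) \<le> norm ((\<phi> o\<^sub>L T h) - \<phi>) * norm (T t)"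
    if "0 < h" for h
  proof -
    have "T t o\<^sub>L T h = T h o\<^sub>L T t"
      using T_add[of t h] T_add[of h t] assms that by (simp add: add.commute)
    then have "T t (T h x) = T h (T t x)" for x
      by (metis blinfun_apply_blinfun_compose)
    then have "((\<phi> o\<^sub>L T t) o\<^sub>L T h) - (\<phi> o\<^sub>L T t) = ((\<phi> o\<^sub>L T h) - \<phi>) o\<^sub>L T t"
      by (intro blinfun_eqI) (simp add: blinfun.diff_left)
    then show ?thesis by (simp add: norm_blinfun_compose)
  qed
  then have "\<forall>\<^sub>F h in at_right 0. norm (norm (((\<phi> o\<^sub>L T t) o\<^sub>L T h) - (\<phi> o\<^sub>L T t)))
      \<le> norm ((\<phi> o\<^sub>L T h) - \<phi>) * norm (T t)"
    unfolding real_norm_def abs_norm_cancel by (rule eventually_mono[OF eventually_at_right_less])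
  then have "((\<lambda>h. norm (((\<phi> o\<^sub>L T t) o\<^sub>L T h) - (\<phi> o\<^sub>L T t))) \<longlongrightarrow> 0) (at_right 0)"
    using lim by (rule Lim_null_comparison)
  moreover have "T t (scaleK c x) = scaleK c (T t x)" for c x
    using T_linear[OF assms(2)] by (simp add: Vector_Spaces.linear_iff)
  ultimately show ?thesis
    using sun_dualD(1)[OF assms(1)] by (simp add: sun_dual_def dual_space_iff)
qed

lemma sun_embedding_in_sun_star: "sun_embedding scaleK T x \<in> sun_star scaleK T"
proof -
  have "norm (sun_embedding scaleK T x \<phi>) \<le> norm x * norm \<phi>" for \<phi> :: "'a \<Rightarrow>\<^sub>L 'k"
    using norm_blinfun[of \<phi> x] by (simp add: sun_embedding_def mult.commute)
  then have "\<exists>C. \<forall>\<phi>\<in>sun_dual scaleK T. norm (sun_embedding scaleK T x \<phi>) \<le> C * norm \<phi>"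
    by blast
  then show ?thesis
    by (simp add: sun_star_def subspace_dual_def)
      (simp add: sun_embedding_def sun_dual_add sun_dual_scale blinfun.add_left)
qed

lemma T_sun_star_in_sun_star:
  assumes "F \<in> sun_star scaleK T" "0 \<le> t"
  shows "T_sun_star scaleK T t F \<in> sun_star scaleK T"
proof -
  let ?S = "sun_dual scaleK T"
  note F = assms(1)[unfolded sun_star_def subspace_dual_def mem_Collect_eq]
  obtain C where C: "\<And>\<phi>. \<phi> \<in> ?S \<Longrightarrow> norm (F \<phi>) \<le> C * norm \<phi>"
    using F by blast
  have bound: "norm (F (\<phi> o\<^sub>L T t)) \<le> (\<bar>C\<bar> * norm (T t)) * norm \<phi>" if "\<phi> \<in> ?S" for \<phi>
  proof -
    have "norm (F (\<phi> o\<^sub>L T t)) \<le> \<bar>C\<bar> * norm (\<phi> o\<^sub>L T t)"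
      using C[OF sun_dual_invariant[OF that assms(2)]]
      by (meson abs_ge_self mult_right_mono norm_ge_zero order_trans)
    also have "\<dots> \<le> \<bar>C\<bar> * (norm \<phi> * norm (T t))"
      by (intro mult_left_mono norm_blinfun_compose) auto
    finally show ?thesis by (simp add: mult_ac)
  qed
  have add: "(\<phi> + \<psi>) o\<^sub>L T t = (\<phi> o\<^sub>L T t) + (\<psi> o\<^sub>L T t)" for \<phi> \<psi> :: "'a \<Rightarrow>\<^sub>L 'k"
    by (intro blinfun_eqI) (simp add: blinfun.bilinear_simps)
  have scale: "dual_scale c \<phi> o\<^sub>L T t = dual_scale c (\<phi> o\<^sub>L T t)" for c and \<phi> :: "'a \<Rightarrow>\<^sub>L 'k"
    by (intro blinfun_eqI) simp
  have "\<exists>D. \<forall>\<phi>\<in>?S. norm (F (\<phi> o\<^sub>L T t)) \<le> D * norm \<phi>"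
    using bound by blast
  then show ?thesis
    using F sun_dual_invariant[OF _ assms(2)]
    by (simp add: sun_star_def subspace_dual_def T_sun_star_def add scale sun_dual_add sun_dual_scale)
qed

lemma Metric_space_sun_star:
  "Metric_space (sun_star scaleK T) (subspace_dual_dist (sun_dual scaleK T))"
  unfolding sun_star_def by (intro Metric_space_subspace_dual sun_dual_0 sun_dual_scale)

end

end

theory Submission
  imports Defs
begin

text \<open>
  Write \<open>(f * T)(s, t)\<close> for the weak* integral of \<open>T\<^sup>\<odot>\<^sup>*(t - \<tau>) f(\<tau>)\<close> over \<open>[s, t]\<close>. Two
  observations carry the proof.

  The convolution is translation invariant. If \<open>a < b\<close> are points of an interval on which \<open>X0\<close> is
  admissible and \<open>t - s \<le> b - a\<close>, then a function on \<open>[s, t]\<close> can be translated so that \<open>s\<close> moves to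
  \<open>a\<close> and extended by its boundary values; hence \<open>(f * T)(s, t)\<close> lies in the range of \<open>j\<close>
  (\<open>admissible_range_short_convolution\<close>).

  The convolution also satisfies a cocycle identity (\<open>sun_star_convolution_split\<close>): for
  \<open>s \<le> u \<le> t\<close>, the value \<open>(f * T)(s, t)\<close> is the sum of \<open>T\<^sup>\<odot>\<^sup>*(t - u) (f * T)(s, u)\<close> and
  \<open>(f * T)(u, t)\<close>. Since \<open>T\<^sup>\<odot>\<^sup>*(r) j x = j T(r) x\<close> and the range of \<open>j\<close> is a subspace, an arbitrary
  interval can be treated by cutting it into finitely many pieces of length at most \<open>b - a\<close>.

  The analytic content lies in the cocycle identity: integrals are additive over adjacent intervals
  only for integrable integrands. The integrand tested against \<open>\<phi> \<in> X\<^sup>\<odot>\<close> is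
  \<open>f(\<tau>)(T(t - \<tau>)\<^sup>* \<phi>)\<close>, which is continuous because \<open>f\<close> is norm continuous and the adjoint orbit
  of \<open>\<phi>\<close> is norm continuous on the whole half-line. The definition of \<open>X\<^sup>\<odot>\<close> provides the latter only
  at \<open>0\<close>; carrying it over to the left of a positive time requires \<open>T\<close> to be bounded in operator norm
  on bounded intervals, which follows from the Baire category theorem.
\<close>

section \<open>The pairing of a subspace with its dual\<close>

lemma continuous_on_subspace_dual_pairing:
  fixes S :: "('a::banach \<Rightarrow>\<^sub>L 'k::{real_normed_field, banach}) set"
  assumes zero: "0 \<in> S"
    and scale: "\<And>c \<phi>. \<phi> \<in> S \<Longrightarrow> dual_scale c \<phi> \<in> S"
    and add: "\<And>\<phi> \<psi>. \<phi> \<in> S \<Longrightarrow> \<psi> \<in> S \<Longrightarrow> \<phi> + \<psi> \<in> S"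
    and f: "continuous_map (top_of_set A) (subspace_dual_topology S) f"
    and g: "continuous_on A g" "g ` A \<subseteq> S"
  shows "continuous_on A (\<lambda>\<tau>. f \<tau> (g \<tau>))"
  \<comment> \<open>Let \<open>N(\<tau>)\<close> be the dual norm of \<open>f(\<tau>) - f(\<sigma>)\<close>. The increment of the pairing is at most
     \<open>N(\<tau>) |g(\<tau>)| + |f(\<sigma>)| |g(\<tau>) - g(\<sigma>)|\<close>, and both terms tend to \<open>0\<close>.\<close>
  unfolding continuous_on_def
proof
  fix \<sigma> assume \<sigma>: "\<sigma> \<in> A"
  interpret M: Metric_space "subspace_dual S" "subspace_dual_dist S"
    by (rule Metric_space_subspace_dual[OF zero scale])
  have f_dual: "f \<tau> \<in> subspace_dual S" if "\<tau> \<in> A" for \<tau>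
    using f that by (auto simp: continuous_map_def subspace_dual_topology_def)
  let ?N = "\<lambda>\<tau>. subspace_dual_norm S (f \<tau> - f \<sigma>)"
  have N_bound: "norm (f \<tau> \<phi> - f \<sigma> \<phi>) \<le> ?N \<tau> * norm \<phi>" if "\<tau> \<in> A" "\<phi> \<in> S" for \<tau> \<phi>
    using subspace_dual_norm_bound[OF subspace_dual_diff[OF f_dual f_dual] _ scale] that \<sigma>
    by fastforce
  have N_lim: "(?N \<longlongrightarrow> 0) (at \<sigma> within A)"
  proof (rule tendstoI)
    fix e :: real assume "0 < e"
    then obtain U where U: "openin (top_of_set A) U" "\<sigma> \<in> U" "\<And>y. y \<in> U \<Longrightarrow> f y \<in> M.mball (f \<sigma>) e"
      using f \<sigma> unfolding subspace_dual_topology_def M.continuous_map_to_metric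
      by (metis topspace_euclidean_subtopology)
    have "dist (?N y) 0 < e" if "y \<in> U" for y
    proof -
      have "y \<in> A" using U(1) that openin_imp_subset by blast
      then have "?N y = subspace_dual_dist S (f \<sigma>) (f y)"
        using f_dual \<sigma> M.commute[of "f \<sigma>" "f y"] by (simp add: subspace_dual_dist_def)
      then show ?thesis using U(3)[OF that] by (simp add: M.nonneg)
    qed
    then show "\<forall>\<^sub>F y in at \<sigma> within A. dist (?N y) 0 < e"
      using U(1,2) by (auto simp: openin_open eventually_at_topological)
  qed
  have g_lim: "(g \<longlongrightarrow> g \<sigma>) (at \<sigma> within A)"
    using g(1) \<sigma> by (simp add: continuous_on_def)
  have "((\<lambda>\<tau>. f \<tau> (g \<tau>) - f \<sigma> (g \<sigma>)) \<longlongrightarrow> 0) (at \<sigma> within A)"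
  proof (rule Lim_null_comparison)
    have "norm (f \<tau> (g \<tau>) - f \<sigma> (g \<sigma>))
        \<le> ?N \<tau> * norm (g \<tau>) + subspace_dual_norm S (f \<sigma>) * norm (g \<tau> - g \<sigma>)"
      if \<tau>: "\<tau> \<in> A" for \<tau>
    proof -
      have gS: "g \<tau> \<in> S" "g \<sigma> \<in> S" using g(2) \<tau> \<sigma> by auto
      have minus: "g \<tau> - g \<sigma> = g \<tau> + dual_scale (-1) (g \<sigma>)"
        by (intro blinfun_eqI) (simp add: blinfun.bilinear_simps)
      have linear: "f \<sigma> (\<phi> + \<psi>) = f \<sigma> \<phi> + f \<sigma> \<psi>" "f \<sigma> (dual_scale c \<phi>) = c * f \<sigma> \<phi>"
        if "\<phi> \<in> S" "\<psi> \<in> S" for \<phi> \<psi> c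
        using f_dual[OF \<sigma>] that unfolding subspace_dual_def by blast+
      have "f \<sigma> (g \<tau> - g \<sigma>) = f \<sigma> (g \<tau>) - f \<sigma> (g \<sigma>)"
        unfolding minus linear(1)[OF gS(1) scale[OF gS(2)]] linear(2)[OF gS(2) gS(2)] by simp
      moreover have "norm (f \<sigma> (g \<tau> - g \<sigma>)) \<le> subspace_dual_norm S (f \<sigma>) * norm (g \<tau> - g \<sigma>)"
        using gS by (intro subspace_dual_norm_bound f_dual \<sigma> scale) (simp_all add: minus add scale)
      ultimately show ?thesis
        using N_bound[OF \<tau> gS(1)]
          norm_triangle_ineq[of "f \<tau> (g \<tau>) - f \<sigma> (g \<tau>)" "f \<sigma> (g \<tau>) - f \<sigma> (g \<sigma>)"]
        by simp
    qed
    then show "\<forall>\<^sub>F \<tau> in at \<sigma> within A. norm (f \<tau> (g \<tau>) - f \<sigma> (g \<sigma>))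
        \<le> ?N \<tau> * norm (g \<tau>) + subspace_dual_norm S (f \<sigma>) * norm (g \<tau> - g \<sigma>)"
      by (simp add: eventually_at_filter)
    show "((\<lambda>\<tau>. ?N \<tau> * norm (g \<tau>) + subspace_dual_norm S (f \<sigma>) * norm (g \<tau> - g \<sigma>)) \<longlongrightarrow> 0)
        (at \<sigma> within A)"
      using tendsto_add[OF tendsto_mult[OF N_lim tendsto_norm[OF g_lim]]
        tendsto_mult[OF tendsto_const[of "subspace_dual_norm S (f \<sigma>)"]
          tendsto_norm[OF tendsto_diff[OF g_lim tendsto_const[of "g \<sigma>"]]]]]
      by simp
  qed
  then show "((\<lambda>\<tau>. f \<tau> (g \<tau>)) \<longlongrightarrow> f \<sigma> (g \<sigma>)) (at \<sigma> within A)"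
    by (rule LIM_zero_cancel)
qed

context C0_semigroup
begin

section \<open>Norm continuity of adjoint orbits on the sun dual\<close>

text \<open>
  This is the uniform boundedness principle for the given family: each orbit is bounded near \<open>0\<close> by
  strong continuity, so the closed sets of vectors whose orbit has norm at most \<open>n\<close> up to time
  \<open>1 / (n + 1)\<close> cover the space, and by Baire one of them contains a ball.
\<close>

lemma locally_bounded_at_0: "\<exists>d>0. \<exists>M. \<forall>t\<in>{0..d}. norm (T t) \<le> M"
proof -
  define B where "B n = {x. \<forall>t\<in>{0..inverse (real (Suc n))}. norm (T t x) \<le> real n}" for n
  have B_closed: "closed (B n)" for n
    unfolding B_def Collect_ball_eq by (intro closed_INT ballI closed_Collect_le continuous_intros)
  have cover: "x \<in> \<Union>(range B)" for x
  proof -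
    have "\<forall>\<^sub>F t in at_right 0. dist (T t x) x < 1"
      using T_strongly_continuous[of x] tendstoD zero_less_one by blast
    then obtain e where e: "0 < e" "\<And>t. 0 < t \<Longrightarrow> t < e \<Longrightarrow> dist (T t x) x < 1"
      by (auto simp: eventually_at_right_field)
    obtain k where k: "inverse (real (Suc k)) < e"
      using reals_Archimedean[OF e(1)] by blast
    obtain m where m: "norm x + 1 \<le> real m" using real_arch_simple by blast
    have "norm (T t x) \<le> real (max k m)" if "t \<in> {0..inverse (real (Suc (max k m)))}" for t
    proof -
      have "inverse (real (Suc (max k m))) \<le> inverse (real (Suc k))" by simp
      then have "t < e" "0 \<le> t"
        using k that unfolding atLeastAtMost_iff by linarith+
      then have "norm (T t x) \<le> norm x + 1"
        using e(2)[of t] T_0 norm_triangle_ineq2[of "T t x" x] by (cases "t = 0") (auto simp: dist_norm)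
      then show ?thesis using m by linarith
    qed
    then show ?thesis unfolding B_def by blast
  qed
  have "\<exists>n. interior (B n) \<noteq> {}"
  proof (rule ccontr)
    assume "\<not> ?thesis"
    then have "euclidean interior_of \<Union>(range B) = {}"
      using B_closed
      by (intro Baire_category_alt) (auto simp: completely_metrizable_space_euclidean)
    moreover have "\<Union>(range B) = UNIV" using cover by blast
    ultimately show False by simp
  qed
  then obtain n x r where r: "0 < r" "cball x r \<subseteq> B n"
    by (metis ex_in_conv interior_subset mem_interior_cball)
  define d where "d = inverse (real (Suc n))"
  have "norm (T t) \<le> 2 * real n / r" if t: "t \<in> {0..d}" for t
  proof (rule norm_blinfun_bound)
    show "norm (T t y) \<le> 2 * real n / r * norm y" for y
    proof (cases "y = 0")
      case False
      \<comment> \<open>\<open>z\<close> is the multiple of \<open>y\<close> that leads from the centre of the ball to its boundary.\<close>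
      define z where "z = (r / norm y) *\<^sub>R y"
      have "norm z = r" using False r(1) by (simp add: z_def)
      then have "x + z \<in> B n" "x \<in> B n" using r by (auto simp: dist_norm)
      then have "norm (T t (x + z)) \<le> real n" "norm (T t x) \<le> real n"
        using t unfolding B_def d_def by blast+
      then have "norm (T t z) \<le> 2 * real n"
        using norm_triangle_ineq4[of "T t (x + z)" "T t x"] by (simp add: blinfun.add_right)
      then have "r / norm y * norm (T t y) \<le> 2 * real n"
        using r(1) by (simp add: z_def blinfun.scaleR_right)
      then show ?thesis using False r(1) by (simp add: field_simps)
    qed simp
  qed (use r in simp)
  moreover have "0 < d" by (simp add: d_def)
  ultimately show ?thesis by blast
qed

text \<open>The semigroup law propagates the bound near \<open>0\<close>, one step of length \<open>d\<close> at a time.\<close>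

lemma bounded_on_bounded_intervals: "\<exists>M\<ge>0. \<forall>t\<in>{0..L}. norm (T t) \<le> M"
proof -
  obtain d M where d: "0 < d" and M: "\<And>t. 0 \<le> t \<Longrightarrow> t \<le> d \<Longrightarrow> norm (T t) \<le> M"
    using locally_bounded_at_0 by (metis atLeastAtMost_iff)
  have "\<exists>K\<ge>0. \<forall>t\<in>{0..real n * d}. norm (T t) \<le> K" for n
  proof (induction n)
    case 0
    show ?case by (intro exI[of _ "norm (T 0)"]) auto
  next
    case (Suc n)
    then obtain K where K: "0 \<le> K" "\<And>t. 0 \<le> t \<Longrightarrow> t \<le> real n * d \<Longrightarrow> norm (T t) \<le> K" by auto
    have M0: "0 \<le> M" using M[of 0] d norm_ge_zero[of "T 0"] by linarith
    have "norm (T t) \<le> max M (K * M)" if t: "0 \<le> t" "t \<le> real (Suc n) * d" for t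
    proof (cases "t \<le> d")
      case True
      then show ?thesis using M t by (simp add: max.coboundedI1)
    next
      case False
      then have "norm (T (t - d)) \<le> K" "norm (T d) \<le> M"
        using t d by (auto intro!: K M simp: algebra_simps)
      moreover have "T t = T (t - d) o\<^sub>L T d" using T_add[of "t - d" d] False d by simp
      ultimately have "norm (T t) \<le> K * M"
        using norm_blinfun_compose[of "T (t - d)" "T d"] K(1) M0
        by (metis mult_mono' norm_ge_zero order_trans)
      then show ?thesis by simp
    qed
    then show ?case using M0 by (intro exI[of _ "max M (K * M)"]) auto
  qed
  moreover obtain n where "L \<le> real n * d"
    using d real_arch_simple[of "L / d"] by (auto simp: field_simps)
  ultimately show ?thesis by (meson atLeastAtMost_iff order_trans)
qed

text \<open>
  The difference of the orbit at \<open>t + h\<close> and at \<open>t\<close> is \<open>(T(h)\<^sup>* \<phi> - \<phi>) o T(t)\<close>. With a bound on the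
  norm of \<open>T(t)\<close> it is small uniformly in \<open>t\<close>, which gives continuity from both sides at once.
\<close>

lemma continuous_on_adjoint_orbit:
  fixes \<phi> :: "'a \<Rightarrow>\<^sub>L 'k"
  assumes "\<phi> \<in> sun_dual scaleK T"
  shows "continuous_on {0..L} (\<lambda>t. \<phi> o\<^sub>L T t)"
proof -
  obtain M where M: "0 \<le> M" "\<And>t. 0 \<le> t \<Longrightarrow> t \<le> L \<Longrightarrow> norm (T t) \<le> M"
    using bounded_on_bounded_intervals by (metis atLeastAtMost_iff)
  have increment: "norm ((\<phi> o\<^sub>L T (t + h)) - (\<phi> o\<^sub>L T t)) \<le> norm ((\<phi> o\<^sub>L T h) - \<phi>) * M"
    if "0 \<le> t" "0 \<le> h" "t + h \<le> L" for t h
  proof -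
    have "(\<phi> o\<^sub>L T (t + h)) - (\<phi> o\<^sub>L T t) = ((\<phi> o\<^sub>L T h) - \<phi>) o\<^sub>L T t"
      using T_add[of h t] that by (intro blinfun_eqI) (simp add: add.commute blinfun.diff_left)
    moreover have "norm (T t) \<le> M" using M(2) that by simp
    ultimately show ?thesis
      using norm_blinfun_compose[of "(\<phi> o\<^sub>L T h) - \<phi>" "T t"]
        mult_left_mono[of "norm (T t)" M "norm ((\<phi> o\<^sub>L T h) - \<phi>)"]
      by simp
  qed
  have "\<exists>\<delta>>0. \<forall>s\<in>{0..L}. \<forall>t\<in>{0..L}. dist s t < \<delta> \<longrightarrow> dist (\<phi> o\<^sub>L T s) (\<phi> o\<^sub>L T t) < e"
    if e: "0 < e" for e
  proof -
    have "((\<lambda>h. norm ((\<phi> o\<^sub>L T h) - \<phi>) * M) \<longlongrightarrow> 0) (at_right 0)"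
      by (intro tendsto_mult_left_zero sun_dualD(2) assms)
    then have "\<forall>\<^sub>F h in at_right 0. norm ((\<phi> o\<^sub>L T h) - \<phi>) * M < e"
      using e by (rule order_tendstoD(2))
    then obtain \<delta> where \<delta>: "0 < \<delta>"
      "\<And>h. 0 < h \<Longrightarrow> h < \<delta> \<Longrightarrow> norm ((\<phi> o\<^sub>L T h) - \<phi>) * M < e"
      by (auto simp: eventually_at_right_field)
    have less: "dist (\<phi> o\<^sub>L T t) (\<phi> o\<^sub>L T s) < e"
      if "s < t" "t - s < \<delta>" "0 \<le> s" "t \<le> L" for s t
      using increment[of s "t - s"] \<delta>(2)[of "t - s"] that by (simp add: dist_norm)
    have "dist (\<phi> o\<^sub>L T s) (\<phi> o\<^sub>L T t) < e"
      if "s \<in> {0..L}" "t \<in> {0..L}" "dist s t < \<delta>" for s t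
      using less[of s t] less[of t s] that e
      by (cases s t rule: linorder_cases) (auto simp: dist_commute dist_real_def)
    with \<delta>(1) show ?thesis by blast
  qed
  then have "uniformly_continuous_on {0..L} (\<lambda>t. \<phi> o\<^sub>L T t)"
    unfolding uniformly_continuous_on_def by metis
  then show ?thesis by (rule uniformly_continuous_imp_continuous)
qed


section \<open>Convolutions with the sun-star semigroup\<close>

abbreviation sun_star_convolution ::
    "(real \<Rightarrow> ('a \<Rightarrow>\<^sub>L 'k) \<Rightarrow> 'k) \<Rightarrow> real \<Rightarrow> real \<Rightarrow> ('a \<Rightarrow>\<^sub>L 'k) \<Rightarrow> 'k"
  where "sun_star_convolution f s t \<equiv>
    weak_star_integral (sun_dual scaleK T) s t (\<lambda>\<tau>. T_sun_star scaleK T (t - \<tau>) (f \<tau>))"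

abbreviation sun_star_topology :: "(('a \<Rightarrow>\<^sub>L 'k) \<Rightarrow> 'k) topology"
  where "sun_star_topology \<equiv> subspace_dual_topology (sun_dual scaleK T)"

lemma continuous_on_convolution_integrand:
  assumes f: "continuous_map (top_of_set {s..t}) sun_star_topology f"
    and \<phi>: "\<phi> \<in> sun_dual scaleK T"
  shows "continuous_on {s..t} (\<lambda>\<tau>. f \<tau> (\<phi> o\<^sub>L T (t - \<tau>)))"
proof (rule continuous_on_subspace_dual_pairing[OF sun_dual_0 sun_dual_scale sun_dual_add f])
  show "continuous_on {s..t} (\<lambda>\<tau>. \<phi> o\<^sub>L T (t - \<tau>))"
    by (rule continuous_on_compose2[OF continuous_on_adjoint_orbit[OF \<phi>, of "t - s"]])
      (auto intro!: continuous_intros)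
  show "(\<lambda>\<tau>. \<phi> o\<^sub>L T (t - \<tau>)) ` {s..t} \<subseteq> sun_dual scaleK T"
    using sun_dual_invariant[OF \<phi>] by auto
qed

text \<open>
  On the first piece \<open>T(t - \<tau>) = T(t - u) T(u - \<tau>)\<close>, and \<open>T\<^sup>\<odot>\<^sup>*(t - u)\<close> can be taken out of a weak*
  integral because it acts by composing the test functional with \<open>T(t - u)\<close>.
\<close>

lemma sun_star_convolution_split:
  assumes f: "continuous_map (top_of_set {s..t}) sun_star_topology f"
    and u: "s \<le> u" "u \<le> t"
  shows "sun_star_convolution f s t =
    T_sun_star scaleK T (t - u) (sun_star_convolution f s u) + sun_star_convolution f u t"
proof
  fix \<phi> :: "'a \<Rightarrow>\<^sub>L 'k"
  show "sun_star_convolution f s t \<phi> =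
    (T_sun_star scaleK T (t - u) (sun_star_convolution f s u) + sun_star_convolution f u t) \<phi>"
  proof (cases "\<phi> \<in> sun_dual scaleK T")
    case True
    let ?q = "\<lambda>\<tau>. f \<tau> (\<phi> o\<^sub>L T (t - \<tau>))"
    have "?q integrable_on {s..t}"
      by (rule integrable_continuous_real[OF continuous_on_convolution_integrand[OF f True]])
    then have "integral {s..t} ?q = integral {s..u} ?q + integral {u..t} ?q"
      using Henstock_Kurzweil_Integration.integral_combine[OF u, symmetric] by blast
    moreover have "integral {s..u} ?q = integral {s..u} (\<lambda>\<tau>. f \<tau> (\<phi> o\<^sub>L T (t - u) o\<^sub>L T (u - \<tau>)))"
    proof (rule integral_cong)
      fix \<tau> assume "\<tau> \<in> {s..u}"
      then have "T (t - \<tau>) = T (t - u) o\<^sub>L T (u - \<tau>)"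
        using T_add[of "t - u" "u - \<tau>"] u by simp
      then have "\<phi> o\<^sub>L T (t - \<tau>) = \<phi> o\<^sub>L T (t - u) o\<^sub>L T (u - \<tau>)"
        by (intro blinfun_eqI) simp
      then show "?q \<tau> = f \<tau> (\<phi> o\<^sub>L T (t - u) o\<^sub>L T (u - \<tau>))"
        by simp
    qed
    ultimately show ?thesis
      using True sun_dual_invariant[OF True, of "t - u"] u
      by (simp add: weak_star_integral_def T_sun_star_def)
  qed (simp add: weak_star_integral_def T_sun_star_def)
qed

lemma sun_star_convolution_shift:
  "sun_star_convolution (\<lambda>\<tau>. f (\<tau> + c)) (s - c) (t - c) = sun_star_convolution f s t"
proof
  fix \<phi> :: "'a \<Rightarrow>\<^sub>L 'k"
  show "sun_star_convolution (\<lambda>\<tau>. f (\<tau> + c)) (s - c) (t - c) \<phi> = sun_star_convolution f s t \<phi>"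
    using integral_shift_real_ivl[of s c t "\<lambda>\<tau>. f \<tau> (\<phi> o\<^sub>L T (t - \<tau>))"]
    by (simp add: weak_star_integral_def T_sun_star_def algebra_simps)
qed

lemma sun_star_convolution_cong:
  assumes "\<And>\<tau>. \<tau> \<in> {s..t} \<Longrightarrow> f \<tau> = g \<tau>"
  shows "sun_star_convolution f s t = sun_star_convolution g s t"
  using assms by (auto simp: weak_star_integral_def T_sun_star_def fun_eq_iff intro!: integral_cong)

lemma T_sun_star_sun_embedding:
  assumes "0 \<le> t"
  shows "T_sun_star scaleK T t (sun_embedding scaleK T x) = sun_embedding scaleK T (T t x)"
  using sun_dual_invariant[OF _ assms]
  by (auto simp: T_sun_star_def sun_embedding_def fun_eq_iff)

lemma sun_embedding_add:
  "sun_embedding scaleK T (x + y) = sun_embedding scaleK T x + sun_embedding scaleK T y"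
  by (auto simp: sun_embedding_def fun_eq_iff blinfun.add_right)


section \<open>From one interval to all intervals\<close>

text \<open>
  Admissibility quantifies over functions that are continuous on all of \<open>J\<close>, so \<open>f\<close> is first extended
  from \<open>[s, t]\<close> to the line by its boundary values and then translated by \<open>s - a\<close>.
\<close>

lemma admissible_range_short_convolution:
  assumes adm: "admissible_range scaleK T J X0"
    and J: "is_interval J" "a \<in> J" "b \<in> J"
    and f: "continuous_map (top_of_set {s..t}) (subtopology sun_star_topology X0) f"
    and st: "s \<le> t" "t - s \<le> b - a"
  shows "sun_star_convolution f s t \<in> range (sun_embedding scaleK T)"
proof -
  let ?c = "s - a"
  define clamp where "clamp \<tau> = max s (min t \<tau>)" for \<tau> :: real
  define g where "g = f \<circ> clamp"
  have "continuous_map (top_of_set J) (top_of_set {s..t}) (\<lambda>\<tau>. clamp (\<tau> + ?c))"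
    using st(1) unfolding clamp_def
    by (auto intro!: continuous_intros)
  from continuous_map_compose[OF this f]
  have "continuous_map (top_of_set J) (subtopology sun_star_topology X0) (\<lambda>\<tau>. g (\<tau> + ?c))"
    by (simp add: g_def o_def)
  moreover have "t - ?c \<in> J"
    using st by (intro mem_is_interval_1_I[OF J]) auto
  ultimately have "sun_star_convolution (\<lambda>\<tau>. g (\<tau> + ?c)) (s - ?c) (t - ?c)
      \<in> range (sun_embedding scaleK T)"
    using adm J(2) st(1) unfolding admissible_range_def by simp
  moreover have "sun_star_convolution g s t = sun_star_convolution f s t"
    by (rule sun_star_convolution_cong) (auto simp: g_def clamp_def)
  ultimately show ?thesis
    unfolding sun_star_convolution_shift by simp
qed

lemma admissible_range_convolution:
  assumes adm: "admissible_range scaleK T J X0"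
    and J: "is_interval J" "a \<in> J" "b \<in> J" "a < b"
    and f: "continuous_map (top_of_set {s..t}) (subtopology sun_star_topology X0) f"
    and st: "s \<le> t"
  shows "sun_star_convolution f s t \<in> range (sun_embedding scaleK T)"
proof -
  have piece: "continuous_map (top_of_set {s'..t'}) (subtopology sun_star_topology X0) f"
    if "s \<le> s'" "t' \<le> t" for s' t'
    using f that by (auto elim!: continuous_map_from_subtopology_mono)
  have "sun_star_convolution f s r \<in> range (sun_embedding scaleK T)"
    if "s \<le> r" "r \<le> t" "r - s \<le> real n * (b - a)" for r n
    using that
  proof (induction n arbitrary: r)
    case 0
    then show ?case
      using admissible_range_short_convolution[OF adm J(1-3) piece] J(4) by simp
  next
    case (Suc n)
    \<comment> \<open>Cut off a last piece \<open>[u, r]\<close> of length at most \<open>b - a\<close>; \<open>max\<close> covers the case that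
       \<open>[s, r]\<close> is itself that short.\<close>
    define u where "u = max s (r - (b - a))"
    have u: "s \<le> u" "u \<le> r" "r - u \<le> b - a" "u - s \<le> real n * (b - a)"
      using Suc.prems J(4) mult_left_mono[of a b "real n"]
      by (auto simp: u_def max_def algebra_simps)
    obtain x where "sun_star_convolution f s u = sun_embedding scaleK T x"
      using Suc.IH[OF u(1) _ u(4)] u(2) Suc.prems(2) by auto
    moreover obtain y where "sun_star_convolution f u r = sun_embedding scaleK T y"
      using admissible_range_short_convolution[OF adm J(1-3) piece u(2,3)] u(1) Suc.prems(2) by auto
    moreover have "continuous_map (top_of_set {s..r}) sun_star_topology f"
      using piece[of s r] Suc.prems(2) by (simp add: continuous_map_in_subtopology)
    ultimately have "sun_star_convolution f s r = sun_embedding scaleK T (T (r - u) x + y)"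
      using sun_star_convolution_split[of s r f u] u
      by (simp add: T_sun_star_sun_embedding sun_embedding_add)
    then show ?case by blast
  qed
  moreover obtain n where "t - s \<le> real n * (b - a)"
    using J(4) real_arch_simple[of "(t - s) / (b - a)"] by (auto simp: field_simps)
  ultimately show ?thesis using st by blast
qed

end

theorem proposition4:
  fixes scaleK :: "'k::{real_normed_field, banach} \<Rightarrow> 'a::banach \<Rightarrow> 'a"
    and T :: "real \<Rightarrow> 'a \<Rightarrow>\<^sub>L 'a"
    and X0 :: "(('a \<Rightarrow>\<^sub>L 'k) \<Rightarrow> 'k) set"
  assumes "C0_semigroup scaleK T"
    and "closed_subspace_of_dual (sun_dual scaleK T) X0"
    and "\<exists>J. nondegenerate_interval J \<and> admissible_range scaleK T J X0"
  shows "\<forall>J. nondegenerate_interval J \<longrightarrow> admissible_range scaleK T J X0"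
proof (intro allI impI)
  interpret C0_semigroup scaleK T by fact
  fix J assume J: "nondegenerate_interval J"
  obtain I a b where I: "is_interval I" "a \<in> I" "b \<in> I" "a < b" "admissible_range scaleK T I X0"
    using assms(3) unfolding nondegenerate_interval_def by blast
  show "admissible_range scaleK T J X0"
    unfolding admissible_range_def
  proof (intro conjI allI impI ballI)
    fix f s t
    assume f: "continuous_map (top_of_set J) (subtopology sun_star_topology X0) f"
      and st: "s \<in> J" "t \<in> J" "s \<le> t"
    have "{s..t} \<subseteq> J"
      using J st mem_is_interval_1_I[of J s t] by (auto simp: nondegenerate_interval_def)
    then have "continuous_map (top_of_set {s..t}) (subtopology sun_star_topology X0) f"
      using f continuous_map_from_subtopology_mono by blast
    then show "sun_star_convolution f s t \<in> range (sun_embedding scaleK T)"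
      by (rule admissible_range_convolution[OF I(5,1-4) _ st(3)])
  qed (rule assms(2))
qed

end
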